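(* Let $m$ and $n$ be positive integers and let $j$, $k$ be non-negative integers. Then $$\frac{(1-q^{n-k})(1-q^{k+1})}{(1-q)(1-q^n)}{n+k\brack 2k}{m+1\brack k+1}{m+k\brack k+1}$$ and $$\frac{1-q}{1-q^{k+1}}{n-1\brack k}{n+k\brack k}{2k\brack j+k}{m+k\brack 2k}{m\brack j}{m+j\brack j}$$ are polynomials in $q$ with non-negative integer coefficients.
   Context: The $q$-binomial coefficients are defined by ${n\brack k}=\prod_{i=1}^{k}\frac{1-q^{n-k+i}}{1-q^i}$ if $0\le k\le n$, and ${n\brack k}=0$ otherwise. *)

theory Defs
  imports "HOL-Computational_Algebra.Computational_Algebra"
begin

text \<open>
  The variable \<open>q\<close> is an indeterminate: all identities live in the field of rational
  functions over the integers.
\<close>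

definition q :: "int poly fract"
  where "q = to_fract [:0, 1:]"

definition qbinom :: "nat \<Rightarrow> nat \<Rightarrow> int poly fract"
  where "qbinom n k =
    (if k \<le> n then \<Prod>i = 1..k. (1 - q ^ (n - k + i)) / (1 - q ^ i) else 0)"

definition nonneg_int_polynomial :: "int poly fract \<Rightarrow> bool"
  where "nonneg_int_polynomial f \<longleftrightarrow>
    (\<exists>p :: int poly. (\<forall>i. 0 \<le> coeff p i) \<and> f = to_fract p)"

end

theory Submission
  imports Defs "HOL-Combinatorics.Transposition"
begin

text \<open>
  Write \<open>[n]\<close> for \<open>1 + q + \<dots> + q^(n-1)\<close> and \<open>[n, k]\<close> for the Gaussian polynomial. From
  \<open>(1 - q^m)(1 - q^(m+1)) = (1 - q^(m+k+1))(1 - q^(m-k)) + q^(m-k) (1 - q^k)(1 - q^(k+1))\<close>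
  one obtains that \<open>[m][m+1][m+k, 2k]/[k+1]\<close> equals
  \<open>(1 + q^(k+1)) [2k+1] [m+k+1, 2k+2] + q^(m-k) [k] [m+k, 2k]\<close>; the first expression of the
  theorem is this polynomial times \<open>[n+k, k] [n-1, k]\<close>.

  The second expression is \<open>P/[k+1]\<close> for a product \<open>P\<close> of Gaussian polynomials. It is a
  polynomial because the set of \<open>c\<close> with \<open>[k+1]\<close> dividing \<open>c P\<close> is an ideal that, with \<open>[a]\<close>
  and \<open>[b]\<close>, contains \<open>[gcd a b]\<close>. It has non-negative coefficients because \<open>P\<close> is symmetric
  and unimodal. Unimodality of Gaussian polynomials follows from an action of sl(2) on the
  exterior powers, realised on functions on the subsets of \<open>{0, \<dots>, N}\<close>.
\<close>

section \<open>Gaussian polynomials\<close>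

definition qint :: "nat \<Rightarrow> int poly"
  where "qint n = (\<Sum>i<n. monom 1 i)"

definition qfact :: "nat \<Rightarrow> int poly"
  where "qfact n = (\<Prod>i=1..n. qint i)"

text \<open>The q-Pascal recursion keeps everything inside the polynomials, and its last term
  corresponds to the subsets that contain the largest element. For \<open>n < k\<close> the
  truncated exponent \<open>n - k\<close> stands next to the factor
  \<open>gauss n k = 0\<close>.\<close>

fun gauss :: "nat \<Rightarrow> nat \<Rightarrow> int poly" where
  "gauss n 0 = 1"
| "gauss 0 (Suc k) = 0"
| "gauss (Suc n) (Suc k) = gauss n (Suc k) + monom 1 (n - k) * gauss n k"

lemma qint_0 [simp]: "qint 0 = 0"
  and qint_1 [simp]: "qint (Suc 0) = 1"
  and qint_Suc: "qint (Suc n) = qint n + monom 1 n"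
  by (simp_all add: qint_def)

lemma coeff_qint: "coeff (qint n) i = (if i < n then 1 else 0)"
  by (simp add: qint_def coeff_sum)

lemma qint_eq_0_iff [simp]: "qint n = 0 \<longleftrightarrow> n = 0"
  using coeff_qint[of n 0] by (cases n) auto

lemma qint_add: "qint (a + b) = qint a + monom 1 a * qint b"
  by (induction b) (simp_all add: qint_Suc algebra_simps mult_monom)

lemma one_minus_q_mult_qint: "(1 - monom 1 (Suc 0)) * qint n = 1 - monom 1 n"
proof (induction n)
  case (Suc n)
  then show ?case
    by (simp only: qint_Suc distrib_left) (simp add: left_diff_distrib mult_monom)
qed simp

text \<open>The cofactor is \<open>[b]\<close> with \<open>q\<close> replaced by
  \<open>q^a\<close>.\<close>

lemma qint_mult: "qint (a * b) = qint a * (\<Sum>i<b. monom 1 (a * i))"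
proof (induction b)
  case (Suc b)
  have "qint (a * Suc b) = qint (a * b) + monom 1 (a * b) * qint a"
    by (simp add: add.commute flip: qint_add)
  then show ?case
    using Suc by (simp add: distrib_left mult.commute)
qed simp

lemma qint_dvd_qint: "a dvd b \<Longrightarrow> qint a dvd qint b"
  by (auto simp: qint_mult)

text \<open>Euclid's algorithm: \<open>[a] = [a mod b] + q^(a mod b) [b (a div b)]\<close>, and the
  last factor is a multiple of \<open>[b]\<close>.\<close>

lemma dvd_qint_gcd_mult:
  assumes "x dvd qint a * w" and "x dvd qint b * w"
  shows "x dvd qint (gcd a b) * w"
  using assms
proof (induction a b rule: gcd_nat_induct)
  case (step a b)
  have "qint a * w = qint (a mod b) * w + monom 1 (a mod b) * (qint (b * (a div b)) * w)"
    using qint_add[of "a mod b" "b * (a div b)"] by (simp add: algebra_simps)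
  moreover have "x dvd qint (b * (a div b)) * w"
    using step.prems(2) by (simp only: qint_mult mult.assoc mult.commute[of _ w])
      (simp only: dvd_mult2 flip: mult.assoc)
  ultimately have "x dvd qint (a mod b) * w"
    using step.prems(1) by (metis dvd_add_left_iff dvd_mult)
  then show ?case
    using step by (simp only: gcd_red_nat[of a b])
qed auto

section \<open>q-factorials and absorption identities\<close>

lemma qfact_0 [simp]: "qfact 0 = 1"
  and qfact_Suc: "qfact (Suc n) = qint (Suc n) * qfact n"
  by (simp_all add: qfact_def mult.commute)

lemma qfact_nonzero [simp]: "qfact n \<noteq> 0"
  by (simp add: qfact_def)

lemma qfact_add: "qfact (a + k) = qfact a * (\<Prod>i=1..k. qint (a + i))"
  by (induction k) (simp_all add: qfact_Suc algebra_simps)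

lemma gauss_eq_0 [simp]: "n < k \<Longrightarrow> gauss n k = 0"
  by (induction n k rule: gauss.induct) auto

text \<open>The factorial formula, free of division. The two terms of the recursion contribute
  \<open>[n-k]\<close> and \<open>q^(n-k) [k+1]\<close>, which add up to
  \<open>[n+1]\<close>.\<close>

lemma gauss_qfact: "k \<le> n \<Longrightarrow> gauss n k * (qfact k * qfact (n - k)) = qfact n"
proof (induction n k rule: gauss.induct)
  case (3 n k)
  show ?case
  proof (cases "k = n")
    case True
    with 3 show ?thesis by (simp add: qfact_Suc mult.left_commute)
  next
    case False
    then have le: "Suc k \<le> n" and "k \<le> n" using 3 by auto
    define d where "d = n - Suc k"
    have n: "n - k = Suc d" "n - Suc k = d" "Suc n = Suc d + Suc k"
      using le by (auto simp: d_def)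
    have "gauss (Suc n) (Suc k) * (qfact (Suc k) * qfact (n - k)) =
        (gauss n (Suc k) * (qfact (Suc k) * qfact d)) * qint (Suc d) +
        monom 1 (Suc d) * qint (Suc k) * (gauss n k * (qfact k * qfact (Suc d)))"
      by (simp only: gauss.simps n(1,2) qfact_Suc) (simp add: algebra_simps)
    also have "\<dots> = qfact n * qint (Suc n)"
      using 3 le \<open>k \<le> n\<close> qint_add[of "Suc d" "Suc k"] by (simp add: n algebra_simps)
    finally show ?thesis by (simp add: qfact_Suc mult.commute)
  qed
qed auto

declare gauss.simps(3) [simp del]

lemma gauss_nonzero: "k \<le> n \<Longrightarrow> gauss n k \<noteq> 0"
  using gauss_qfact[of k n] by auto

text \<open>Multiplied by suitable q-factorials, both sides become the same q-factorial expression,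
  and the nonzero factor is cancelled; outside the range of \<open>k\<close> both sides are 0. The
  two further absorption rules follow in the same way.\<close>

lemma gauss_absorb_top: "qint (Suc k) * gauss (Suc n) (Suc k) = qint (Suc n) * gauss n k"
proof (cases "k \<le> n")
  case True
  have "(qint (Suc k) * gauss (Suc n) (Suc k)) * (qfact k * qfact (n - k)) =
      gauss (Suc n) (Suc k) * (qfact (Suc k) * qfact (Suc n - Suc k))"
    by (simp add: qfact_Suc algebra_simps)
  also have "\<dots> = qfact (Suc n)"
    using True by (intro gauss_qfact) simp
  also have "\<dots> = (qint (Suc n) * gauss n k) * (qfact k * qfact (n - k))"
    using gauss_qfact[OF True] by (simp add: qfact_Suc mult.assoc)
  finally show ?thesis by simp
qed simp

lemma gauss_absorb_right: "qint (Suc k) * gauss n (Suc k) = qint (n - k) * gauss n k"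
proof (cases "k < n")
  case True
  then obtain d where n: "n = Suc (k + d)"
    using less_imp_Suc_add by blast
  have "(qint (Suc k) * gauss n (Suc k)) * (qfact k * qfact d) =
      gauss n (Suc k) * (qfact (Suc k) * qfact (n - Suc k))"
    by (simp add: n qfact_Suc algebra_simps)
  also have "\<dots> = gauss n k * (qfact k * qfact (n - k))"
    using True by (subst (1 2) gauss_qfact) auto
  also have "\<dots> = (qint (n - k) * gauss n k) * (qfact k * qfact d)"
    by (simp add: n qfact_Suc algebra_simps)
  finally show ?thesis by simp
qed simp

lemma gauss_absorb_left: "qint (Suc n - k) * gauss (Suc n) k = qint (Suc n) * gauss n k"
proof (cases "k \<le> n")
  case True
  have "(qint (Suc n - k) * gauss (Suc n) k) * (qfact k * qfact (n - k)) =
      gauss (Suc n) k * (qfact k * qfact (Suc n - k))"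
    using True by (simp add: Suc_diff_le qfact_Suc algebra_simps)
  also have "\<dots> = qint (Suc n) * (gauss n k * (qfact k * qfact (n - k)))"
    using True by (simp only: gauss_qfact le_SucI qfact_Suc)
  finally show ?thesis by (simp add: mult.assoc)
qed simp

text \<open>Both sides are the q-multinomial coefficient of \<open>m + k\<close> with parts
  \<open>k\<close>, \<open>k\<close> and \<open>m - k\<close>.\<close>

lemma gauss_central_mult:
  assumes "k \<le> m"
  shows "gauss (m + k) (2 * k) * gauss (2 * k) k = gauss m k * gauss (m + k) k"
proof -
  have "gauss (m + k) (2 * k) * gauss (2 * k) k * (qfact k * qfact k * qfact (m - k) * qfact m) =
      (gauss (m + k) (2 * k) * ((gauss (2 * k) k * (qfact k * qfact (2 * k - k)))
         * qfact (m + k - 2 * k))) * qfact m"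
    by (simp add: algebra_simps)
  also have "\<dots> = qfact (m + k) * qfact m"
    using assms by (simp only: gauss_qfact)
  also have "\<dots> = (gauss (m + k) k * (qfact k * qfact (m + k - k))) *
      (gauss m k * (qfact k * qfact (m - k)))"
    using assms by (simp only: gauss_qfact le_add2)
  also have "\<dots> = gauss m k * gauss (m + k) k * (qfact k * qfact k * qfact (m - k) * qfact m)"
    by (simp add: algebra_simps)
  finally show ?thesis by simp
qed

section \<open>The explicit quotient by \<open>[k+1]\<close>\<close>

lemma qint_mult_qint_Suc:
  assumes "k \<le> m"
  shows "qint m * qint (Suc m) =
    qint (m + k + 1) * qint (m - k) + monom 1 (m - k) * qint k * qint (Suc k)"
proof -
  define d where "d = m - k"
  have m: "m = d + k" using assms by (simp add: d_def)
  \<comment> \<open>Clearing \<open>(1 - q)^2\<close> turns every \<open>[a]\<close> into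
    \<open>1 - q^a\<close>, which leaves an identity between powers of \<open>q\<close>. The
    constant coefficient shows that \<open>1 - q\<close> can be cancelled.\<close>
  have "coeff (1 - monom 1 (Suc 0) :: int poly) 0 \<noteq> 0"
    by simp
  then have nz: "(1 - monom 1 (Suc 0) :: int poly) \<noteq> 0"
    by (metis coeff_0)
  have "((1 - monom 1 (Suc 0)) * qint m) * ((1 - monom 1 (Suc 0)) * qint (Suc m)) =
    ((1 - monom 1 (Suc 0)) * qint (m + k + 1)) * ((1 - monom 1 (Suc 0)) * qint (m - k)) +
    monom 1 (m - k) * ((1 - monom 1 (Suc 0)) * qint k) * ((1 - monom 1 (Suc 0)) * qint (Suc k))"
    unfolding one_minus_q_mult_qint by (simp add: m algebra_simps mult_monom)
  then have "(1 - monom 1 (Suc 0)) * ((1 - monom 1 (Suc 0)) * (qint m * qint (Suc m))) =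
    (1 - monom 1 (Suc 0)) * ((1 - monom 1 (Suc 0)) *
      (qint (m + k + 1) * qint (m - k) + monom 1 (m - k) * qint k * qint (Suc k)))"
    by (simp only: algebra_simps)
  then show ?thesis
    using nz by (simp only: mult_cancel_left) simp
qed

text \<open>A form of \<open>[m][m+1][m+k, 2k]/[k+1]\<close> in which every summand is a product of
  polynomials with non-negative coefficients.\<close>

definition gauss_quot :: "nat \<Rightarrow> nat \<Rightarrow> int poly"
  where "gauss_quot m k = (1 + monom 1 (Suc k)) * qint (2 * k + 1) * gauss (m + k + 1) (2 * k + 2)
    + monom 1 (m - k) * qint k * gauss (m + k) (2 * k)"

text \<open>Two absorptions turn \<open>[m+k+1][m-k][m+k, 2k]\<close> into
  \<open>[2k+2][2k+1][m+k+1, 2k+2]\<close>, and \<open>[2k+2] = [k+1] (1 + q^(k+1))\<close>. The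
  other term of \<open>[m][m+1]\<close> has the factor \<open>[k+1]\<close> already.\<close>

lemma gauss_quot:
  assumes "k \<le> m"
  shows "qint m * qint (Suc m) * gauss (m + k) (2 * k) = qint (Suc k) * gauss_quot m k"
proof -
  have 1: "qint (2 * k + 2) = qint (Suc k) * (1 + monom 1 (Suc k))"
    using qint_add[of "Suc k" "Suc k"] by (simp add: algebra_simps flip: mult_2_right)
  have "qint (2 * k + 2) * qint (2 * k + 1) * gauss (m + k + 1) (2 * k + 2) =
      qint (2 * k + 1) * (qint (m + k + 1) * gauss (m + k) (2 * k + 1))"
    using gauss_absorb_top[of "2 * k + 1" "m + k"] by (simp add: algebra_simps)
  also have "\<dots> = qint (m + k + 1) * (qint (m - k) * gauss (m + k) (2 * k))"
    using gauss_absorb_right[of "2 * k" "m + k"] by (simp add: algebra_simps)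
  finally have "qint (m + k + 1) * qint (m - k) * gauss (m + k) (2 * k) =
      qint (Suc k) * ((1 + monom 1 (Suc k)) * qint (2 * k + 1) * gauss (m + k + 1) (2 * k + 2))"
    unfolding 1 by (simp add: mult.assoc)
  then show ?thesis
    unfolding qint_mult_qint_Suc[OF assms] gauss_quot_def by (simp add: distrib_left distrib_right mult_ac)
qed

section \<open>Divisibility of the second product by \<open>[k+1]\<close>\<close>

lemma content_qint: "n > 0 \<Longrightarrow> content (qint n) = 1"
  using content_dvd_coeff[of "qint n" 0] by (metis coeff_qint is_unit_normalize normalize_content)

text \<open>Gauss's lemma: \<open>[n]\<close> has content 1, so \<open>t\<close> divides the content
  of the cofactor \<open>v\<close> and can be cancelled.\<close>

lemma qint_dvd_cancel_const:
  assumes "n > 0" and "t \<noteq> 0" and "qint n dvd [:t:] * w"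
  shows "qint n dvd w"
proof -
  obtain v where v: "[:t:] * w = qint n * v" using assms(3) by (elim dvdE)
  then have "t dvd content (qint n * v)"
    by (metis const_poly_dvd_iff_dvd_content dvd_triv_left)
  then have "[:t:] dvd v"
    using assms(1) by (simp add: content_mult content_qint const_poly_dvd_iff_dvd_content)
  then obtain u where "v = [:t:] * u" by (elim dvdE)
  with v have "[:t:] * w = [:t:] * (qint n * u)" by (simp only: mult_ac)
  then have "w = qint n * u" using assms(2) by (simp only: mult_cancel_left) simp
  then show ?thesis by simp
qed

text \<open>With \<open>h = gcd j (k+1)\<close> and \<open>k + 1 = h t\<close>, both \<open>[h]\<close> and \<open>[k+1]/[h]\<close>, which is congruent
  to the integer \<open>t\<close> modulo \<open>[h]\<close>, lie in the ideal of multipliers. Hence so does \<open>t\<close>, and it can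
  be cancelled because \<open>[k+1]\<close> is primitive.\<close>

lemma qint_Suc_dvd_gauss_product:
  assumes "k \<le> m" and "j \<le> k"
  shows "qint (Suc k) dvd
    gauss (2 * k) (j + k) * gauss (m + k) (2 * k) * gauss m j * gauss (m + j) j"
proof -
  define w where
    "w = gauss (2 * k) (j + k) * gauss (m + k) (2 * k) * gauss m j * gauss (m + j) j"
  define h where "h = gcd j (Suc k)"
  have quot: "qint (Suc k) dvd qint m * qint (Suc m) * gauss (m + k) (2 * k)"
    using gauss_quot[OF assms(1)] by simp
  \<comment> \<open>Absorption trades \<open>[j]\<close> for \<open>[m]\<close> in
    \<open>[m, j]\<close>, or for \<open>[m+1]\<close> in \<open>[m+j, j]\<close>. So
    \<open>[m+1][j] w\<close> and \<open>[m][j] w\<close> both contain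
    \<open>[m][m+1][m+k, 2k]\<close>, and \<open>gcd (m + 1) m = 1\<close> removes the extra
    factor.\<close>
  have j: "qint (Suc k) dvd qint j * w"
  proof (cases j)
    case (Suc i)
    then obtain m' where m': "m = Suc m'" using assms by (cases m) auto
    have "qint (Suc m) * (qint j * w) = (qint j * gauss m j) *
        (qint (Suc m) * gauss (m + k) (2 * k) * gauss (2 * k) (j + k) * gauss (m + j) j)"
      by (simp only: w_def mult_ac)
    also have "qint j * gauss m j = qint m * gauss m' i"
      unfolding Suc m' by (rule gauss_absorb_top)
    also have "qint m * gauss m' i *
        (qint (Suc m) * gauss (m + k) (2 * k) * gauss (2 * k) (j + k) * gauss (m + j) j) =
        qint m * qint (Suc m) * gauss (m + k) (2 * k) *
        (gauss (2 * k) (j + k) * gauss m' i * gauss (m + j) j)"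
      by (simp only: mult_ac)
    finally have "qint (Suc m) * (qint j * w) = \<dots>" .
    then have "qint (Suc k) dvd qint (Suc m) * (qint j * w)"
      using quot by (metis dvd_mult2)
    moreover have "qint (Suc k) dvd qint m * (qint j * w)"
    proof -
      have "qint m * (qint j * w) = (qint j * gauss (m + j) j) *
          (qint m * gauss (m + k) (2 * k) * gauss (2 * k) (j + k) * gauss m j)"
        by (simp only: w_def mult_ac)
      also have "qint j * gauss (m + j) j = qint (Suc m) * gauss (m + j) i"
        using gauss_absorb_right[of i "m + j"] by (simp add: Suc)
      also have "qint (Suc m) * gauss (m + j) i *
          (qint m * gauss (m + k) (2 * k) * gauss (2 * k) (j + k) * gauss m j) =
          qint m * qint (Suc m) * gauss (m + k) (2 * k) *
          (gauss (2 * k) (j + k) * gauss m j * gauss (m + j) i)"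
        by (simp only: mult_ac)
      finally show ?thesis
        using quot by (metis dvd_mult2)
    qed
    ultimately have "qint (Suc k) dvd qint (gcd (Suc m) m) * (qint j * w)"
      by (rule dvd_qint_gcd_mult)
    moreover have "gcd (Suc m) m = Suc 0"
      by simp
    ultimately show ?thesis by simp
  qed simp
  then have h: "qint (Suc k) dvd qint h * w"
    unfolding h_def by (rule dvd_qint_gcd_mult) simp
  \<comment> \<open>Absorption in \<open>[2k, j+k]\<close> gives \<open>[2k+1] w\<close> the factor
    \<open>[j+k+1]\<close>, a multiple of \<open>[h]\<close>. As a divisor of \<open>k + 1\<close>,
    \<open>h\<close> is coprime to \<open>2k + 1\<close>, so \<open>[h]\<close> divides
    \<open>w\<close>.\<close>
  have "qint h dvd qint (2 * k + 1) * w"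
  proof -
    have "qint (Suc (2 * k)) * w = qint (Suc (j + k)) * (gauss (Suc (2 * k)) (Suc (j + k)) *
        gauss (m + k) (2 * k) * gauss m j * gauss (m + j) j)"
      using gauss_absorb_top[of "j + k" "2 * k"] by (simp only: w_def mult.assoc[symmetric])
    moreover have "h dvd Suc (j + k)"
      unfolding h_def by (metis add_Suc_right dvd_add gcd_dvd1 gcd_dvd2)
    ultimately show ?thesis
      by (simp add: qint_dvd_qint)
  qed
  then have "qint h dvd qint (gcd (2 * k + 1) h) * w"
    by (rule dvd_qint_gcd_mult) simp
  moreover have "gcd (2 * k + 1) h = 1"
  proof -
    have "coprime (2 * k + 1) (Suc k)"
    proof (rule coprimeI)
      fix c assume "c dvd 2 * k + 1" "c dvd Suc k"
      then have "c dvd 2 * Suc k - (2 * k + 1)" by (intro dvd_diff_nat dvd_mult)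
      then show "is_unit c" by simp
    qed
    then show ?thesis
      unfolding h_def by (metis coprime_iff_gcd_eq_1 coprime_divisors dvd_refl gcd_dvd2)
  qed
  ultimately have hw: "qint h dvd w" by simp
  obtain t where t: "Suc k = h * t" unfolding h_def by (meson dvdE gcd_dvd2)
  define T where "T = (\<Sum>i<t. monom (1::int) (h * i))"
  have "qint (Suc k) dvd T * w"
    unfolding t qint_mult T_def[symmetric] using hw by (metis dvd_refl mult.commute mult_dvd_mono)
  moreover have "qint h dvd [:int t:] - T"
  proof -
    have "[:int t:] - T = (\<Sum>i<t. 1 - monom 1 (h * i))"
      by (simp add: T_def sum_subtractf of_nat_poly)
    also have "qint h dvd \<dots>"
      by (intro dvd_sum) (metis one_minus_q_mult_qint dvd_mult dvd_triv_left qint_dvd_qint)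
    finally show ?thesis .
  qed
  then have "qint (Suc k) dvd ([:int t:] - T) * w"
    using h by (meson dvd_trans dvd_refl mult_dvd_mono)
  ultimately have "qint (Suc k) dvd T * w + ([:int t:] - T) * w"
    by (rule dvd_add)
  then have "qint (Suc k) dvd [:int t:] * w"
    by (simp only: distrib_right[symmetric]) simp
  moreover have "int t \<noteq> 0" using t by (cases t) auto
  ultimately have "qint (Suc k) dvd w"
    using qint_dvd_cancel_const[of "Suc k" "int t" w] by simp
  then show ?thesis
    by (simp only: w_def)
qed

section \<open>Symmetric unimodal polynomials\<close>

text \<open>Symmetric about \<open>d/2\<close> and unimodal with non-negative coefficients: the cone spanned by the
  blocks \<open>q^a [d-2a+1]\<close>. The parameter \<open>d\<close> is the sum of the lowest and the highest exponent.\<close>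

inductive symm_unimodal :: "nat \<Rightarrow> int poly \<Rightarrow> bool" where
  zero: "symm_unimodal d 0"
| add: "symm_unimodal d p \<Longrightarrow> symm_unimodal d r \<Longrightarrow> symm_unimodal d (p + r)"
| block: "c \<ge> 0 \<Longrightarrow> symm_unimodal (2 * a + l) (monom c a * qint (Suc l))"

lemma coeff_block: "coeff (monom c a * qint l) i = (if a \<le> i \<and> i < a + l then c else 0)"
  by (auto simp: coeff_monom_mult coeff_qint)

lemma symm_unimodal_sum:
  "(\<And>i. i \<in> A \<Longrightarrow> symm_unimodal d (f i)) \<Longrightarrow> symm_unimodal d (\<Sum>i\<in>A. f i)"
  by (induction A rule: infinite_finite_induct) (auto intro: symm_unimodal.intros)

text \<open>The block starting at \<open>q^a\<close> gets the increment \<open>p_a - p_(a-1)\<close>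
  as multiplicity, non-negative up to the middle. The blocks that cover the exponent
  \<open>i \<le> d\<close> are those with \<open>a \<le> min i (d - i)\<close>; their multiplicities
  telescope to \<open>p_i\<close> by symmetry.\<close>

lemma symm_unimodal_coeffI:
  assumes nonneg: "0 \<le> coeff p 0"
    and symm: "\<And>i. i \<le> d \<Longrightarrow> coeff p (d - i) = coeff p i"
    and deg: "\<And>i. d < i \<Longrightarrow> coeff p i = 0"
    and mono: "\<And>i. 2 * i < d \<Longrightarrow> coeff p i \<le> coeff p (Suc i)"
  shows "symm_unimodal d p"
proof -
  define c where "c a = (case a of 0 \<Rightarrow> coeff p 0 | Suc b \<Rightarrow> coeff p a - coeff p b)" for a
  have telescope: "(\<Sum>a\<le>i. c a) = coeff p i" for i
    by (induction i) (auto simp: c_def)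
  have "p = (\<Sum>a\<le>d div 2. monom (c a) a * qint (Suc (d - 2 * a)))"
  proof (rule poly_eqI)
    fix i
    have "coeff (\<Sum>a\<le>d div 2. monom (c a) a * qint (Suc (d - 2 * a))) i =
        (\<Sum>a\<le>d div 2. if a \<le> i \<and> i < a + Suc (d - 2 * a) then c a else 0)"
      by (simp add: coeff_sum coeff_block)
    also have "\<dots> = (\<Sum>a | a \<le> d div 2 \<and> a \<le> i \<and> i < a + Suc (d - 2 * a). c a)"
      by (rule sum.mono_neutral_cong_right) auto
    also have "{a. a \<le> d div 2 \<and> a \<le> i \<and> i < a + Suc (d - 2 * a)} =
        (if i \<le> d then {..min i (d - i)} else {})"
      by auto
    also have "(\<Sum>a\<in>\<dots>. c a) = coeff p i"
      using symm[of i] deg[of i] by (auto simp: telescope min_def)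
    finally show "coeff p i = coeff (\<Sum>a\<le>d div 2. monom (c a) a * qint (Suc (d - 2 * a))) i"
      by simp
  qed
  moreover have "symm_unimodal d (monom (c a) a * qint (Suc (d - 2 * a)))" if "a \<le> d div 2" for a
  proof -
    have "c a \<ge> 0"
      using nonneg mono that by (cases a) (auto simp: c_def)
    then have "symm_unimodal (2 * a + (d - 2 * a)) (monom (c a) a * qint (Suc (d - 2 * a)))"
      by (rule symm_unimodal.block)
    then show ?thesis using that by simp
  qed
  ultimately show ?thesis
    using symm_unimodal_sum[of "{..d div 2}" d] by simp
qed

lemma symm_unimodal_shift:
  assumes "symm_unimodal d p" and "c \<ge> 0"
  shows "symm_unimodal (2 * a + d) (monom c a * p)"
  using assms
proof (induction rule: symm_unimodal.induct)
  case (block c' a' l)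
  then have "symm_unimodal (2 * (a + a') + l) (monom (c * c') (a + a') * qint (Suc l))"
    by (intro symm_unimodal.block) simp
  then show ?case
    by (simp add: mult_monom add_ac distrib_left flip: mult.assoc)
qed (auto simp: distrib_left intro: symm_unimodal.intros)

text \<open>A q-Clebsch-Gordan rule: \<open>[r+2][s+1] = [r+s+2] + q [r+1][s]\<close> peels off the
  longest block, and both summands have the same centre.\<close>

lemma symm_unimodal_qint_mult: "symm_unimodal (r + s) (qint (Suc r) * qint (Suc s))"
proof (induction r arbitrary: s)
  case 0
  show ?case using symm_unimodal.block[of 1 0 s] by simp
next
  case (Suc r)
  have block: "symm_unimodal (Suc r + s) (qint (Suc (Suc r + s)))"
    using symm_unimodal.block[of 1 0 "Suc r + s"] by simp
  show ?case
  proof (cases s)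
    case 0
    with block show ?thesis by simp
  next
    case (Suc s')
    have "qint (Suc (Suc r)) * qint (Suc s) =
        qint (Suc s) + monom 1 (Suc s) * qint (Suc r) + monom 1 1 * (qint (Suc r) * qint (Suc s'))"
      using qint_add[of 1 "Suc r"] qint_add[of "Suc s'" 1]
      by (simp add: Suc algebra_simps mult_monom)
    also have "qint (Suc s) + monom 1 (Suc s) * qint (Suc r) = qint (Suc (Suc r + s))"
      using qint_add[of "Suc s" "Suc r"] by (simp add: add_ac)
    finally show ?thesis
      using block symm_unimodal_shift[OF Suc.IH[of s'], of 1 1]
      by (auto simp: Suc intro: symm_unimodal.add)
  qed
qed

text \<open>By bilinearity it suffices to multiply two blocks, hence the nested induction.\<close>

lemma symm_unimodal_mult:
  assumes "symm_unimodal d p" and "symm_unimodal e r"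
  shows "symm_unimodal (d + e) (p * r)"
  using assms
proof (induction rule: symm_unimodal.induct)
  case (block c a l)
  from block.prems block.hyps show ?case
  proof (induction rule: symm_unimodal.induct)
    case (block c' a' l')
    then have "symm_unimodal (2 * (a + a') + (l + l'))
        (monom (c * c') (a + a') * (qint (Suc l) * qint (Suc l')))"
      by (intro symm_unimodal_shift symm_unimodal_qint_mult) simp
    moreover have "monom (c * c') (a + a') * (qint (Suc l) * qint (Suc l')) =
        monom c a * qint (Suc l) * (monom c' a' * qint (Suc l'))"
      unfolding mult_monom[of c a c' a', symmetric] by (simp only: mult_ac)
    ultimately have "symm_unimodal (2 * (a + a') + (l + l'))
        (monom c a * qint (Suc l) * (monom c' a' * qint (Suc l')))"
      by (simp only:)
    then show ?case
      by (simp add: distrib_left add_ac)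
  qed (auto simp: distrib_left intro: symm_unimodal.intros)
qed (auto simp: distrib_right intro: symm_unimodal.intros)

text \<open>A block occupies an interval centred at \<open>d/2\<close>, so it covers
  \<open>i\<close> whenever it covers an \<open>i'\<close> at least as far from the centre.\<close>

lemma symm_unimodal_coeff_le:
  assumes "symm_unimodal d p" and "\<bar>2 * int i - int d\<bar> \<le> \<bar>2 * int i' - int d\<bar>"
  shows "coeff p i' \<le> coeff p i"
  using assms by (induction rule: symm_unimodal.induct) (auto simp: coeff_block intro: add_mono)

lemma symm_unimodal_coeff_nonneg: "symm_unimodal d p \<Longrightarrow> 0 \<le> coeff p i"
  by (induction rule: symm_unimodal.induct) (auto simp: coeff_block)

text \<open>Write \<open>p_i\<close> for coefficients. The relation \<open>r_i - r_(i-b) = p_i - p_(i-1)\<close> is read upwards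
  below the middle degree of \<open>p\<close> and downwards above it.\<close>

lemma coeff_nonneg_if_quotient_symm_unimodal:
  assumes su: "symm_unimodal d p" and b: "b > 0" and eq: "p = qint b * r"
  shows "0 \<le> coeff r i"
proof -
  have "(1 - monom 1 (Suc 0)) * p = (1 - monom 1 b) * r"
    unfolding eq one_minus_q_mult_qint[of b, symmetric] by (simp only: mult.assoc)
  then have coeff_eq: "coeff ((1 - monom 1 (Suc 0)) * p) i = coeff ((1 - monom 1 b) * r) i" for i
    by simp
  have rec: "coeff r i = (if i < b then 0 else coeff r (i - b)) +
      (coeff p i - (if i = 0 then 0 else coeff p (i - 1)))" for i
    using coeff_eq[of i] by (simp add: left_diff_distrib coeff_monom_mult split: if_splits)
  \<comment> \<open>For \<open>i > 0\<close>, the index \<open>i\<close> is no farther from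
    \<open>d/2\<close> than \<open>i - 1\<close> exactly when
    \<open>2 * i \<le> Suc d\<close>.\<close>
  show ?thesis
  proof (cases "2 * i \<le> Suc d")
    case True
    then show ?thesis
    proof (induction i rule: less_induct)
      case (less i)
      have "(if i = 0 then 0 else coeff p (i - 1)) \<le> coeff p i"
        using less.prems symm_unimodal_coeff_le[OF su, of i "i - 1"]
          symm_unimodal_coeff_nonneg[OF su, of i] by auto
      moreover have "0 \<le> (if i < b then 0 else coeff r (i - b))"
        using less b by auto
      ultimately show ?case by (subst rec) simp
    qed
  next
    case False
    \<comment> \<open>The recurrence at \<open>i + b\<close> gives
      \<open>r_i = r_(i+b) + (p_(i+b-1) - p_(i+b))\<close>, whose bracket is non-negative past the
      middle. The descent starts above the degree of \<open>r\<close>.\<close>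
    then show ?thesis
    proof (induction "Suc (degree r) - i" arbitrary: i rule: less_induct)
      case less
      show ?case
      proof (cases "degree r < i")
        case True
        then show ?thesis by (simp add: coeff_eq_0)
      next
        case False
        then have "0 \<le> coeff r (i + b)"
          using less b by simp
        moreover have "coeff p (i + b) \<le> coeff p (i + b - 1)"
          using less.prems b by (intro symm_unimodal_coeff_le[OF su]) auto
        ultimately show ?thesis
          using rec[of "i + b"] b by simp
      qed
    qed
  qed
qed

section \<open>Unimodality of Gaussian polynomials\<close>

text \<open>Gaussian elimination: \<open>M'\<close> clears column \<open>p\<close> with the pivot
  \<open>M b p\<close>, and a solution on \<open>A - {p}\<close> is extended by the value at
  \<open>p\<close> that solves row \<open>b\<close>.\<close>

lemma homogeneous_system_nontrivial_solution:
  fixes M :: "'b \<Rightarrow> 'a \<Rightarrow> real"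
  assumes "finite B" and "finite A" and "card B < card A"
  shows "\<exists>f. (\<exists>a\<in>A. f a \<noteq> 0) \<and> (\<forall>b\<in>B. (\<Sum>a\<in>A. M b a * f a) = 0)"
  using assms
proof (induction B arbitrary: A M rule: finite_induct)
  case empty
  then have "A \<noteq> {}" by auto
  then show ?case by (intro exI[of _ "\<lambda>_. 1"]) auto
next
  case (insert b B)
  show ?case
  proof (cases "\<exists>a\<in>A. M b a \<noteq> 0")
    case False
    have "card B < card A" using insert by simp
    from insert.IH[OF insert.prems(1) this, of M] show ?thesis
      using False by auto
  next
    case True
    then obtain p where p: "p \<in> A" "M b p \<noteq> 0" by blast
    define M' where "M' c a = M c a - M c p * M b a / M b p" for c a
    have "card B < card (A - {p})" using insert p by simp
    from insert.IH[OF _ this, of M'] insert.prems(1) obtain f where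
      f: "\<exists>a\<in>A - {p}. f a \<noteq> 0" "\<And>c. c \<in> B \<Longrightarrow> (\<Sum>a\<in>A - {p}. M' c a * f a) = 0"
      by auto
    define g where "g = f(p := - (\<Sum>a\<in>A - {p}. M b a * f a) / M b p)"
    have sum_g: "(\<Sum>a\<in>A. M c a * g a) = M c p * g p + (\<Sum>a\<in>A - {p}. M c a * f a)" for c
      using insert.prems(1) p(1) by (simp add: sum.remove[of A p] g_def)
    have "(\<Sum>a\<in>A. M c a * g a) = 0" if "c \<in> insert b B" for c
    proof (cases "c = b")
      case True
      then show ?thesis using p(2) by (simp add: sum_g) (simp add: g_def)
    next
      case False
      have "0 = (\<Sum>a\<in>A - {p}. M' c a * f a)"
        using f(2) that False by simp
      also have "\<dots> = (\<Sum>a\<in>A - {p}. M c a * f a - M c p / M b p * (M b a * f a))"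
        by (simp add: M'_def left_diff_distrib mult.assoc)
      also have "\<dots> = (\<Sum>a\<in>A - {p}. M c a * f a) + M c p * g p"
        unfolding sum_subtractf sum_distrib_left[symmetric] by (simp add: g_def)
      finally show ?thesis by (simp add: sum_g)
    qed
    moreover have "\<exists>a\<in>A. g a \<noteq> 0" using f(1) by (auto simp: g_def)
    ultimately show ?thesis by blast
  qed
qed

section \<open>Raising and lowering operators on functions on finite sets\<close>

definition swap_set :: "nat \<Rightarrow> nat set \<Rightarrow> nat set"
  where "swap_set i S = transpose i (Suc i) ` S"

lemma mem_swap_set: "x \<in> swap_set i S \<longleftrightarrow> transpose i (Suc i) x \<in> S"
  unfolding swap_set_def by (metis image_iff transpose_involutory)

lemma swap_set_involutory [simp]: "swap_set i (swap_set i S) = S"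
  by (auto simp: mem_swap_set)

lemma swap_set_commute: "Suc i < j \<Longrightarrow> swap_set i (swap_set j S) = swap_set j (swap_set i S)"
  by (auto simp: mem_swap_set transpose_def)

lemma swap_set_subset: "Suc i < N \<Longrightarrow> S \<subseteq> {..<N} \<Longrightarrow> swap_set i S \<subseteq> {..<N}"
  by (auto simp: swap_set_def transpose_def)

lemma card_swap_set [simp]: "card (swap_set i S) = card S"
  by (simp add: swap_set_def card_image)

lemma sum_swap_set:
  assumes "finite S" and "i \<notin> S" and "Suc i \<in> S"
  shows "\<Sum>S = Suc (\<Sum>(swap_set i S))"
proof -
  have "swap_set i S = insert i (S - {Suc i})"
    using assms by (auto simp: mem_swap_set transpose_def split: if_splits)
  then show ?thesis
    using assms by (simp add: sum.remove[of S "Suc i"])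
qed

lemma bij_betw_swap_set: "Suc i < N \<Longrightarrow> bij_betw (swap_set i) (Pow {..<N}) (Pow {..<N})"
  by (rule bij_betw_byWitness[where f' = "swap_set i"]) (auto dest: swap_set_subset)

text \<open>Moving an element is phrased by a transposition for this purpose: it is an involution of
  the whole power set, so sums can be reindexed freely.\<close>

lemma sum_swap_set_reindex:
  "Suc i < N \<Longrightarrow> (\<Sum>S\<in>Pow {..<N}. F (swap_set i S)) = (\<Sum>S\<in>Pow {..<N}. F S)"
  by (rule sum.reindex_bij_betw[OF bij_betw_swap_set])

text \<open>\<open>raise f i\<close> is the image of \<open>f\<close> under the operator moving the element \<open>i\<close> of a set to \<open>i + 1\<close>,
  and \<open>lower f i\<close> is its image under the adjoint operator.\<close>

definition raise :: "(nat set \<Rightarrow> real) \<Rightarrow> nat \<Rightarrow> nat set \<Rightarrow> real"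
  where "raise f i S = (if i \<notin> S \<and> Suc i \<in> S then f (swap_set i S) else 0)"

definition lower :: "(nat set \<Rightarrow> real) \<Rightarrow> nat \<Rightarrow> nat set \<Rightarrow> real"
  where "lower f i S = (if i \<in> S \<and> Suc i \<notin> S then f (swap_set i S) else 0)"

text \<open>The off-diagonal commutators vanish. For \<open>j = i + 1\<close> both products are 0,
  as \<open>i + 1\<close> would have to be in \<open>S\<close> and outside it. Otherwise the swaps
  commute, and replacing \<open>S\<close> by its image under both exchanges the two
  products.\<close>

lemma sum_raise_mult_raise_less:
  assumes "i < j" and "Suc j < N"
  shows "(\<Sum>S\<in>Pow {..<N}. raise f i S * raise f j S) = (\<Sum>S\<in>Pow {..<N}. lower f i S * lower f j S)"
proof (cases "j = Suc i")
  case True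
  have "raise f i S * raise f j S = 0" "lower f i S * lower f j S = 0" for S
    by (auto simp: raise_def lower_def True)
  then show ?thesis by (simp only:)
next
  case False
  with assms have less: "Suc i < j" by simp
  have "raise f i (swap_set j (swap_set i S)) * raise f j (swap_set j (swap_set i S)) =
      lower f i S * lower f j S" for S
  proof -
    have "swap_set i (swap_set j (swap_set i S)) = swap_set j S"
      by (simp only: swap_set_commute[OF less] swap_set_involutory)
    moreover have "i \<in> swap_set j (swap_set i S) \<longleftrightarrow> Suc i \<in> S"
      "Suc i \<in> swap_set j (swap_set i S) \<longleftrightarrow> i \<in> S"
      "j \<in> swap_set j (swap_set i S) \<longleftrightarrow> Suc j \<in> S"
      "Suc j \<in> swap_set j (swap_set i S) \<longleftrightarrow> j \<in> S"
      using less by (auto simp: mem_swap_set transpose_def)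
    ultimately show ?thesis
      by (auto simp: raise_def lower_def)
  qed
  then have "(\<Sum>S\<in>Pow {..<N}. lower f i S * lower f j S) =
      (\<Sum>S\<in>Pow {..<N}. raise f i (swap_set j (swap_set i S)) * raise f j (swap_set j (swap_set i S)))"
    by (simp only:)
  also have "\<dots> = (\<Sum>S\<in>Pow {..<N}. raise f i (swap_set j S) * raise f j (swap_set j S))"
    using assms by (intro sum_swap_set_reindex) simp
  also have "\<dots> = (\<Sum>S\<in>Pow {..<N}. raise f i S * raise f j S)"
    using assms by (intro sum_swap_set_reindex)
  finally show ?thesis by simp
qed

lemma sum_raise_mult_raise:
  assumes "i \<noteq> j" and "Suc i < N" and "Suc j < N"
  shows "(\<Sum>S\<in>Pow {..<N}. raise f i S * raise f j S) = (\<Sum>S\<in>Pow {..<N}. lower f i S * lower f j S)"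
proof (cases "i < j")
  case False
  then have "j < i" using assms by simp
  then show ?thesis
    using sum_raise_mult_raise_less[of j i N f] assms by (simp only: mult.commute)
qed (use assms in \<open>simp add: sum_raise_mult_raise_less\<close>)

text \<open>After reindexing by the swap, raising sees \<open>f\<close> on the sets with
  \<open>i\<close> but not \<open>i + 1\<close>, and lowering sees it on those with
  \<open>i + 1\<close> but not \<open>i\<close>.\<close>

lemma sum_raise_sq:
  assumes "Suc i < N"
  shows "(\<Sum>S\<in>Pow {..<N}. raise f i S * raise f i S) - (\<Sum>S\<in>Pow {..<N}. lower f i S * lower f i S) =
    (\<Sum>S\<in>Pow {..<N}. (of_bool (i \<in> S) - of_bool (Suc i \<in> S)) * (f S)\<^sup>2)"
proof -
  have "raise f i (swap_set i S) * raise f i (swap_set i S) -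
      lower f i (swap_set i S) * lower f i (swap_set i S) =
      (of_bool (i \<in> S) - of_bool (Suc i \<in> S)) * (f S)\<^sup>2" for S
    by (auto simp: raise_def lower_def mem_swap_set power2_eq_square)
  then have "(\<Sum>S\<in>Pow {..<N}. (of_bool (i \<in> S) - of_bool (Suc i \<in> S)) * (f S)\<^sup>2) =
      (\<Sum>S\<in>Pow {..<N}. raise f i (swap_set i S) * raise f i (swap_set i S) -
        lower f i (swap_set i S) * lower f i (swap_set i S))"
    by (simp only:)
  also have "\<dots> = (\<Sum>S\<in>Pow {..<N}. raise f i S * raise f i S - lower f i S * lower f i S)"
    using assms by (rule sum_swap_set_reindex)
  finally show ?thesis by (simp only: sum_subtractf)
qed

text \<open>Tested against \<open>f\<close>, this is the commutator relation between the weighted raising operator and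
  its adjoint.\<close>

lemma raise_norm_minus_lower_norm:
  fixes c :: "nat \<Rightarrow> real"
  shows "(\<Sum>S\<in>Pow {..<Suc N}. (\<Sum>i<N. c i * raise f i S)\<^sup>2) -
      (\<Sum>S\<in>Pow {..<Suc N}. (\<Sum>i<N. c i * lower f i S)\<^sup>2) =
    (\<Sum>S\<in>Pow {..<Suc N}. (\<Sum>i<N. (c i)\<^sup>2 * (of_bool (i \<in> S) - of_bool (Suc i \<in> S))) * (f S)\<^sup>2)"
    (is "?R - ?L = _")
proof -
  let ?P = "Pow {..<Suc N}"
  have expand: "(\<Sum>S\<in>?P. (\<Sum>i<N. c i * g i S)\<^sup>2) = (\<Sum>i<N. \<Sum>j<N. c i * c j * (\<Sum>S\<in>?P. g i S * g j S))"
    for g :: "nat \<Rightarrow> nat set \<Rightarrow> real"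
  proof -
    have "(\<Sum>S\<in>?P. (\<Sum>i<N. c i * g i S)\<^sup>2) = (\<Sum>S\<in>?P. \<Sum>i<N. \<Sum>j<N. c i * c j * (g i S * g j S))"
      by (simp add: power2_eq_square sum_product mult_ac)
    also have "\<dots> = (\<Sum>i<N. \<Sum>S\<in>?P. \<Sum>j<N. c i * c j * (g i S * g j S))"
      by (rule sum.swap)
    also have "\<dots> = (\<Sum>i<N. \<Sum>j<N. \<Sum>S\<in>?P. c i * c j * (g i S * g j S))"
      by (intro sum.cong refl sum.swap)
    finally show ?thesis by (simp only: sum_distrib_left)
  qed
  let ?D = "\<lambda>i. \<Sum>S\<in>?P. (of_bool (i \<in> S) - of_bool (Suc i \<in> S)) * (f S)\<^sup>2"
  have "?R - ?L = (\<Sum>i<N. \<Sum>j<N. c i * c j *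
      ((\<Sum>S\<in>?P. raise f i S * raise f j S) - (\<Sum>S\<in>?P. lower f i S * lower f j S)))"
    unfolding expand by (simp only: sum_subtractf right_diff_distrib)
  \<comment> \<open>Only the diagonal of the double sum survives.\<close>
  also have "\<dots> = (\<Sum>i<N. \<Sum>j<N. if j = i then (c i)\<^sup>2 * ?D i else 0)"
    by (intro sum.cong refl) (auto simp: sum_raise_sq sum_raise_mult_raise power2_eq_square)
  also have "\<dots> = (\<Sum>i<N. (c i)\<^sup>2 * ?D i)"
    by simp
  also have "\<dots> = (\<Sum>i<N. \<Sum>S\<in>?P. (c i)\<^sup>2 * (of_bool (i \<in> S) - of_bool (Suc i \<in> S)) * (f S)\<^sup>2)"
    by (simp only: sum_distrib_left mult.assoc)
  also have "\<dots> = (\<Sum>S\<in>?P. \<Sum>i<N. (c i)\<^sup>2 * (of_bool (i \<in> S) - of_bool (Suc i \<in> S)) * (f S)\<^sup>2)"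
    by (rule sum.swap)
  finally show ?thesis by (simp only: sum_distrib_right)
qed

text \<open>Summation by parts with \<open>(i + 1) (N - i) - i (N + 1 - i) = N - 2 i\<close>. With
  these weights the commutator acts on a set by a scalar that depends only on its size and
  sum.\<close>

lemma sum_weights:
  assumes "S \<subseteq> {..<Suc N}"
  shows "(\<Sum>i<N. real ((i + 1) * (N - i)) * (of_bool (i \<in> S) - of_bool (Suc i \<in> S))) =
    real (card S * N) - 2 * real (\<Sum>S)"
proof -
  have "(\<Sum>i<N. real ((i + 1) * (N - i)) * (of_bool (i \<in> S) - of_bool (Suc i \<in> S))) =
      (\<Sum>i<N. real ((i + 1) * (N - i)) * of_bool (i \<in> S)) -
      (\<Sum>i<N. real ((i + 1) * (N - i)) * of_bool (Suc i \<in> S))"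
    by (simp only: right_diff_distrib sum_subtractf)
  \<comment> \<open>The weight at \<open>i = N\<close> is 0, and after the index shift below so is
    the one at \<open>i = 0\<close>; both sums can therefore run over
    \<open>{..<Suc N}\<close>.\<close>
  also have "(\<Sum>i<N. real ((i + 1) * (N - i)) * of_bool (i \<in> S)) =
      (\<Sum>i<Suc N. real ((i + 1) * (N - i)) * of_bool (i \<in> S))"
    by simp
  also have "(\<Sum>i<N. real ((i + 1) * (N - i)) * of_bool (Suc i \<in> S)) =
      (\<Sum>i<Suc N. real (i * (Suc N - i)) * of_bool (i \<in> S))"
    by (subst sum.lessThan_Suc_shift) simp
  also have "(\<Sum>i<Suc N. real ((i + 1) * (N - i)) * of_bool (i \<in> S)) - \<dots> =
      (\<Sum>i<Suc N. if i \<in> S then real N - 2 * real i else 0)"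
    unfolding sum_subtractf[symmetric]
  proof (intro sum.cong refl)
    fix i assume "i \<in> {..<Suc N}"
    then have "real (N - i) = real N - real i" "real (Suc N - i) = real N + 1 - real i"
      by (simp_all add: of_nat_diff)
    then show "real ((i + 1) * (N - i)) * of_bool (i \<in> S) - real (i * (Suc N - i)) * of_bool (i \<in> S) =
        (if i \<in> S then real N - 2 * real i else 0)"
      by (simp only: of_nat_mult) (simp add: algebra_simps)
  qed
  also have "\<dots> = (\<Sum>i\<in>S. real N - 2 * real i)"
    using assms by (intro sum.mono_neutral_cong_right) auto
  also have "\<dots> = real (card S * N) - 2 * real (\<Sum>S)"
    by (simp add: sum_subtractf sum_distrib_left)
  finally show ?thesis .
qed

section \<open>Counting subsets by size and sum; Gaussian polynomials as generating
  functions\<close>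

definition subsets_with_sum :: "nat \<Rightarrow> nat \<Rightarrow> nat \<Rightarrow> nat set set"
  where "subsets_with_sum N n s = {S. S \<subseteq> {..<N} \<and> card S = n \<and> \<Sum>S = s}"

lemma finite_subsets_with_sum: "finite (subsets_with_sum N n s)"
  by (rule finite_subset[of _ "Pow {..<N}"]) (auto simp: subsets_with_sum_def)

text \<open>With the weights \<open>c i = sqrt ((i + 1) (N - i))\<close>, the norm of the raised function exceeds that of
  the lowered one by \<open>n N - 2 s > 0\<close> times the norm of \<open>f\<close>, so raising is injective.\<close>

lemma card_subsets_with_sum_mono:
  assumes "2 * s < n * N"
  shows "card (subsets_with_sum (Suc N) n s) \<le> card (subsets_with_sum (Suc N) n (Suc s))"
proof (rule ccontr)
  let ?A = "subsets_with_sum (Suc N) n s" and ?B = "subsets_with_sum (Suc N) n (Suc s)"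
  let ?P = "Pow {..<Suc N}"
  define c where "c i = sqrt (real ((i + 1) * (N - i)))" for i
  \<comment> \<open>The matrix of the weighted raising operator from functions on \<open>?A\<close>
    to functions on \<open>?B\<close>. More columns than rows give a nonzero kernel vector
    \<open>f0\<close>.\<close>
  define M where "M S' S = (\<Sum>i<N. c i * raise (\<lambda>T. of_bool (T = S)) i S')" for S' S
  assume "\<not> card ?A \<le> card ?B"
  then obtain f0 where f0: "\<exists>S\<in>?A. f0 S \<noteq> 0" "\<And>S'. S' \<in> ?B \<Longrightarrow> (\<Sum>S\<in>?A. M S' S * f0 S) = 0"
    using homogeneous_system_nontrivial_solution[of ?B ?A M] finite_subsets_with_sum
    by (metis not_le)
  define f where "f S = (if S \<in> ?A then f0 S else 0)" for S
  have raise_f: "(\<Sum>i<N. c i * raise f i S') = (\<Sum>S\<in>?A. M S' S * f0 S)" for S'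
  proof -
    have "raise f i S' = (\<Sum>S\<in>?A. raise (\<lambda>T. of_bool (T = S)) i S' * f0 S)" for i
    proof -
      have "raise (\<lambda>T. of_bool (T = S)) i S' * f0 S = (if S = swap_set i S' then raise f0 i S' else 0)" for S
        by (auto simp: raise_def)
      then show ?thesis
        by (simp add: finite_subsets_with_sum) (simp add: raise_def f_def)
    qed
    then have "(\<Sum>i<N. c i * raise f i S') =
        (\<Sum>i<N. \<Sum>S\<in>?A. c i * raise (\<lambda>T. of_bool (T = S)) i S' * f0 S)"
      by (simp add: sum_distrib_left mult.assoc)
    also have "\<dots> = (\<Sum>S\<in>?A. \<Sum>i<N. c i * raise (\<lambda>T. of_bool (T = S)) i S' * f0 S)"
      by (rule sum.swap)
    finally show ?thesis by (simp add: M_def sum_distrib_right)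
  qed
  \<comment> \<open>On \<open>?B\<close> this is the choice of \<open>f0\<close>; elsewhere it holds
    because \<open>f\<close> is supported on \<open>?A\<close> and raising increases the sum by
    exactly 1.\<close>
  have "(\<Sum>i<N. c i * raise f i S) = 0" if S: "S \<in> ?P" for S
  proof (cases "S \<in> ?B")
    case True
    then show ?thesis by (simp add: raise_f f0)
  next
    case False
    have "raise f i S = 0" if "i < N" for i
    proof (rule ccontr)
      assume "raise f i S \<noteq> 0"
      then have *: "i \<notin> S" "Suc i \<in> S" "swap_set i S \<in> ?A"
        by (auto simp: raise_def f_def split: if_splits)
      moreover have "finite S" using S finite_subset by auto
      ultimately have "S \<in> ?B"
        using S sum_swap_set[of S i] by (auto simp: subsets_with_sum_def)
      with False show False by simp
    qed
    then show ?thesis by simp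
  qed
  then have "(\<Sum>S\<in>?P. (\<Sum>i<N. c i * raise f i S)\<^sup>2) = 0"
    by simp
  then have "(\<Sum>S\<in>?P. (\<Sum>i<N. (c i)\<^sup>2 * (of_bool (i \<in> S) - of_bool (Suc i \<in> S))) * (f S)\<^sup>2) \<le> 0"
    unfolding raise_norm_minus_lower_norm[symmetric] by (simp add: sum_nonneg)
  also have "(\<Sum>S\<in>?P. (\<Sum>i<N. (c i)\<^sup>2 * (of_bool (i \<in> S) - of_bool (Suc i \<in> S))) * (f S)\<^sup>2) =
      (\<Sum>S\<in>?P. (real (n * N) - 2 * real s) * (f S)\<^sup>2)"
  proof (intro sum.cong refl)
    fix S assume S: "S \<in> ?P"
    show "(\<Sum>i<N. (c i)\<^sup>2 * (of_bool (i \<in> S) - of_bool (Suc i \<in> S))) * (f S)\<^sup>2 =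
        (real (n * N) - 2 * real s) * (f S)\<^sup>2"
    proof (cases "S \<in> ?A")
      case True
      then show ?thesis
        using sum_weights[of S N] by (simp add: c_def subsets_with_sum_def del: of_nat_mult of_nat_sum)
    qed (simp add: f_def)
  qed
  also have "\<dots> = (real (n * N) - 2 * real s) * (\<Sum>S\<in>?P. (f S)\<^sup>2)"
    by (simp only: sum_distrib_left)
  finally have "(\<Sum>S\<in>?P. (f S)\<^sup>2) \<le> 0"
    using assms by (simp add: mult_le_0_iff flip: of_nat_mult)
  then have "(\<Sum>S\<in>?P. (f S)\<^sup>2) = 0"
    by (intro antisym sum_nonneg) auto
  then have "\<forall>S\<in>?P. f S = 0"
    by (subst (asm) sum_nonneg_eq_0_iff) auto
  moreover have "?A \<subseteq> ?P"
    by (auto simp: subsets_with_sum_def)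
  ultimately show False
    using f0(1) by (auto simp: f_def split: if_splits)
qed

text \<open>The reflection \<open>x \<mapsto> N - x\<close> of \<open>{..<Suc N}\<close> takes sets
  of size \<open>n\<close> and sum \<open>s\<close> to sets of sum \<open>n N - s\<close> and is an
  involution.\<close>

lemma card_subsets_with_sum_symm:
  assumes "s + s' = n * N"
  shows "card (subsets_with_sum (Suc N) n s) = card (subsets_with_sum (Suc N) n s')"
proof -
  have "(\<lambda>S. (\<lambda>x. N - x) ` S) ` subsets_with_sum (Suc N) n s \<subseteq> subsets_with_sum (Suc N) n s'"
    and "(\<lambda>S. (\<lambda>x. N - x) ` S) ` ((\<lambda>S. (\<lambda>x. N - x) ` S) ` subsets_with_sum (Suc N) n s) = subsets_with_sum (Suc N) n s"
    if eq: "s + s' = n * N" for s s'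
  proof -
    have inj: "inj_on (\<lambda>x. N - x) S" if "S \<subseteq> {..<Suc N}" for S
      using that by (intro inj_onI) (auto simp: subset_eq less_Suc_eq_le, metis diff_diff_cancel)
    show "(\<lambda>S. (\<lambda>x. N - x) ` S) ` subsets_with_sum (Suc N) n s \<subseteq> subsets_with_sum (Suc N) n s'"
    proof (rule image_subsetI)
      fix S assume "S \<in> subsets_with_sum (Suc N) n s"
      then have S: "S \<subseteq> {..<Suc N}" "card S = n" "\<Sum>S = s"
        by (auto simp: subsets_with_sum_def)
      have "(\<Sum>x\<in>S. N - x) + \<Sum>S = (\<Sum>x\<in>S. N)"
        unfolding sum.distrib[symmetric] using S(1) by (intro sum.cong) auto
      then have "(\<Sum>x\<in>S. N - x) = s'"
        using S eq by simp
      then show "(\<lambda>x. N - x) ` S \<in> subsets_with_sum (Suc N) n s'"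
        using S inj[OF S(1)] by (auto simp: subsets_with_sum_def card_image sum.reindex)
    qed
    have "(\<lambda>x. N - x) ` (\<lambda>x. N - x) ` S = S" if "S \<subseteq> {..<Suc N}" for S
    proof -
      have "(\<lambda>x. N - (N - x)) ` S = (\<lambda>x. x) ` S"
        using that by (intro image_cong) auto
      then show ?thesis by (simp add: image_image)
    qed
    then show "(\<lambda>S. (\<lambda>x. N - x) ` S) ` ((\<lambda>S. (\<lambda>x. N - x) ` S) ` subsets_with_sum (Suc N) n s) =
        subsets_with_sum (Suc N) n s"
      by (simp add: image_image subsets_with_sum_def cong: image_cong_simp)
  qed
  note complement = this
  have "card (subsets_with_sum (Suc N) n s) \<le> card (subsets_with_sum (Suc N) n s')"
    if "s + s' = n * N" for s s'
    using complement[OF that] finite_subsets_with_sum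
    by (metis surj_card_le card_mono finite_imageI finite_subset le_trans order_refl)
  from this[of s s'] this[of s' s] show ?thesis
    using assms by (simp add: add.commute)
qed

text \<open>Splitting the subsets by whether they contain \<open>N\<close> reproduces the q-Pascal
  recursion. The prefactor accounts for the smallest sum \<open>0 + ... + (n - 1)\<close> of
  \<open>n\<close> elements.\<close>

lemma sum_subsets_eq_gauss:
  "(\<Sum>S | S \<subseteq> {..<N} \<and> card S = n. monom 1 (\<Sum>S)) = monom 1 (\<Sum>{..<n}) * gauss N n"
proof (induction N n rule: gauss.induct)
  case (1 N)
  have "{S. S \<subseteq> {..<N} \<and> card S = 0} = {{}}"
    using finite_subset by fastforce
  then show ?case by simp
next
  case (2 n)
  have "{S. S \<subseteq> {..<0::nat} \<and> card S = Suc n} = {}" by auto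
  then show ?case by simp
next
  case (3 N n)
  let ?F = "\<lambda>n. {S. S \<subseteq> {..<N} \<and> card S = n}"
  have fin: "finite (?F n)" for n
    by (rule finite_subset[of _ "Pow {..<N}"]) auto
  have finS: "finite S" "N \<notin> S" if "S \<in> ?F n" for n S
    using that finite_subset by auto
  have split: "{S. S \<subseteq> {..<Suc N} \<and> card S = Suc n} = ?F (Suc n) \<union> insert N ` ?F n"
  proof (intro equalityI subsetI)
    fix S assume S: "S \<in> {S. S \<subseteq> {..<Suc N} \<and> card S = Suc n}"
    then have "finite S" using finite_subset by auto
    show "S \<in> ?F (Suc n) \<union> insert N ` ?F n"
    proof (cases "N \<in> S")
      case True
      then have "S = insert N (S - {N})" "S - {N} \<in> ?F n"
        using S \<open>finite S\<close> by (auto simp: lessThan_Suc)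
      then show ?thesis by blast
    qed (use S in \<open>auto simp: lessThan_Suc\<close>)
  next
    fix S assume "S \<in> ?F (Suc n) \<union> insert N ` ?F n"
    then show "S \<in> {S. S \<subseteq> {..<Suc N} \<and> card S = Suc n}"
    proof
      assume "S \<in> insert N ` ?F n"
      then obtain T where "S = insert N T" and T: "T \<in> ?F n" by blast
      with finS[OF T] show ?thesis by (auto simp: lessThan_Suc)
    qed auto
  qed
  have inj: "inj_on (insert N) (?F n)"
  proof (rule inj_onI)
    fix S T assume S: "S \<in> ?F n" and T: "T \<in> ?F n" and "insert N S = insert N T"
    then show "S = T"
      using insert_ident[OF finS(2)[OF S] finS(2)[OF T]] by (simp only:)
  qed
  have "(\<Sum>S | S \<subseteq> {..<Suc N} \<and> card S = Suc n. monom 1 (\<Sum>S)) =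
      (\<Sum>S\<in>?F (Suc n). monom 1 (\<Sum>S)) + (\<Sum>S\<in>insert N ` ?F n. monom (1::int) (\<Sum>S))"
    unfolding split by (rule sum.union_disjoint[OF fin finite_imageI[OF fin]]) auto
  also have "(\<Sum>S\<in>insert N ` ?F n. monom (1::int) (\<Sum>S)) = (\<Sum>S\<in>?F n. monom 1 N * monom 1 (\<Sum>S))"
    unfolding sum.reindex[OF inj]
  proof (intro sum.cong refl)
    fix S assume "S \<in> ?F n"
    from finS[OF this] show "((\<lambda>S. monom (1::int) (\<Sum>S)) \<circ> insert N) S = monom 1 N * monom 1 (\<Sum>S)"
      by (simp add: mult_monom)
  qed
  also have "\<dots> = monom 1 N * (monom 1 (\<Sum>{..<n}) * gauss N n)"
    by (simp only: 3 flip: sum_distrib_left)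
  \<comment> \<open>For \<open>n \<le> N\<close>, \<open>q^N = q^n q^(N-n)\<close>, and
    \<open>q^n\<close> extends the smallest sum; otherwise \<open>gauss N n\<close> is 0.\<close>
  also have "\<dots> = monom 1 (\<Sum>{..<Suc n}) * (monom 1 (N - n) * gauss N n)"
  proof (cases "n \<le> N")
    case True
    then show ?thesis by (simp add: mult_monom add_ac flip: mult.assoc)
  qed simp
  finally show ?case
    unfolding 3 gauss.simps by (simp only: distrib_left)
qed

lemma coeff_gauss: "coeff (gauss N n) i = int (card (subsets_with_sum N n (i + \<Sum>{..<n})))"
proof -
  have "finite {S. S \<subseteq> {..<N} \<and> card S = n}"
    by (rule finite_subset[of _ "Pow {..<N}"]) auto
  have "coeff (gauss N n) i = coeff (monom 1 (\<Sum>{..<n}) * gauss N n) (i + \<Sum>{..<n})"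
    by (simp add: coeff_monom_mult)
  also have "\<dots> = (\<Sum>S | S \<subseteq> {..<N} \<and> card S = n. if \<Sum>S = i + \<Sum>{..<n} then 1 else 0)"
    unfolding sum_subsets_eq_gauss[symmetric] by (simp add: coeff_sum)
  also have "\<dots> = (\<Sum>S\<in>subsets_with_sum N n (i + \<Sum>{..<n}). 1)"
    by (rule sum.mono_neutral_cong_right)
      (use \<open>finite {S. S \<subseteq> {..<N} \<and> card S = n}\<close> in \<open>auto simp: subsets_with_sum_def\<close>)
  finally show ?thesis by simp
qed

lemma coeff_gauss_nonneg: "0 \<le> coeff (gauss N n) i"
  by (simp add: coeff_gauss)

lemma coeff_gauss_eq_0: "n * (N - n) < i \<Longrightarrow> coeff (gauss N n) i = 0"
proof (induction N n arbitrary: i rule: gauss.induct)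
  case (3 N n)
  have "Suc n * (N - Suc n) \<le> Suc n * (N - n)"
    by (intro mult_le_mono) auto
  also have "\<dots> < i" using "3.prems" by simp
  finally have "coeff (gauss N (Suc n)) i = 0" by (rule 3)
  moreover have "coeff (gauss N n) (i - (N - n)) = 0"
    using "3.prems" by (intro 3) simp
  ultimately show ?case
    by (simp add: gauss.simps coeff_monom_mult)
qed (auto simp: coeff_1)

lemma two_mult_sum_lessThan: "2 * \<Sum>{..<n} + n = n * (n::nat)"
  by (induction n) auto

lemma symm_unimodal_gauss: "symm_unimodal (n * (N - n)) (gauss N n)"
proof (cases "n \<le> N")
  case le: True
  show ?thesis
  proof (cases N)
    case 0
    with le show ?thesis
      using symm_unimodal.block[of 1 0 0] by simp
  next
    case (Suc M)
    define c where "c = \<Sum>{..<n}"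
    \<comment> \<open>Exponent \<open>i\<close> corresponds to the sum \<open>i + c\<close>. With
      \<open>N = M + 1\<close>, reflecting exponents in \<open>n (N - n)\<close> therefore means
      reflecting sums in \<open>n M\<close>.\<close>
    have sum_eq: "n * (N - n) + 2 * c = n * M"
    proof -
      have "n * (N - n) + n * n = n * N"
        using le by (simp flip: distrib_left)
      then show ?thesis
        using two_mult_sum_lessThan[of n] unfolding c_def[symmetric] Suc by simp
    qed
    show ?thesis
    proof (rule symm_unimodal_coeffI)
      fix i assume "i \<le> n * (N - n)"
      then show "coeff (gauss N n) (n * (N - n) - i) = coeff (gauss N n) i"
        using sum_eq unfolding coeff_gauss c_def[symmetric] Suc
        by (intro arg_cong[of _ _ int] card_subsets_with_sum_symm) simp
    next
      fix i assume i: "2 * i < n * (N - n)"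
      then show "coeff (gauss N n) i \<le> coeff (gauss N n) (Suc i)"
        using sum_eq card_subsets_with_sum_mono[of "i + c" n M]
        unfolding coeff_gauss c_def[symmetric] Suc by simp
    qed (simp_all add: coeff_gauss_nonneg coeff_gauss_eq_0)
  qed
qed (simp add: symm_unimodal.zero)

section \<open>The field of rational functions\<close>

lemma nonneg_coeff_mult:
  fixes p r :: "int poly"
  assumes "\<And>i. 0 \<le> coeff p i" and "\<And>i. 0 \<le> coeff r i"
  shows "0 \<le> coeff (p * r) i"
  using assms by (auto simp: coeff_mult intro!: sum_nonneg)

lemma coeff_gauss_quot_nonneg: "0 \<le> coeff (gauss_quot m k) i"
  unfolding gauss_quot_def coeff_add
  by (intro add_nonneg_nonneg nonneg_coeff_mult coeff_gauss_nonneg) (simp_all add: coeff_qint coeff_1)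

lemma to_fract_monom: "to_fract (monom 1 n) = q ^ n"
proof (induction n)
  case (Suc n)
  have "monom (1::int) (Suc n) = [:0, 1:] * monom 1 n"
    by (simp add: monom_Suc)
  then show ?case
    using Suc by (simp only: to_fract_mult power_Suc flip: q_def)
qed simp

lemma one_minus_q_power: "1 - q ^ n = (1 - q) * to_fract (qint n)"
  using arg_cong[OF one_minus_q_mult_qint[of n], of to_fract] to_fract_monom[of 1]
  by (simp add: to_fract_monom)

lemma one_minus_q_nonzero: "1 - q \<noteq> 0"
proof -
  have "coeff (1 - monom 1 1 :: int poly) 0 \<noteq> 0"
    by simp
  then have "1 - monom 1 1 \<noteq> (0 :: int poly)"
    by (metis coeff_0)
  then have "to_fract (1 - monom 1 1 :: int poly) \<noteq> 0"
    by (subst to_fract_eq_0_iff)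
  then show ?thesis
    by (simp only: to_fract_diff to_fract_monom to_fract_1 power_one_right simp_thms)
qed

lemma to_fract_prod: "to_fract (\<Prod>i\<in>A. f i) = (\<Prod>i\<in>A. to_fract (f i))"
  by (induction A rule: infinite_finite_induct) simp_all

text \<open>By \<open>1 - q^a = (1 - q) [a]\<close> the factors \<open>1 - q\<close> cancel in each
  quotient, which leaves the factorial formula.\<close>

lemma qbinom_eq_gauss: "qbinom n k = to_fract (gauss n k)"
proof (cases "k \<le> n")
  case True
  have "qbinom n k = (\<Prod>i=1..k. to_fract (qint (n - k + i)) / to_fract (qint i))"
    using True one_minus_q_nonzero by (simp add: qbinom_def one_minus_q_power)
  also have "\<dots> = to_fract (\<Prod>i=1..k. qint (n - k + i)) / to_fract (qfact k)"
    by (simp only: prod_dividef to_fract_prod qfact_def)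
  also have "\<dots> = to_fract (gauss n k)"
  proof -
    have "qfact (n - k) * (gauss n k * qfact k) = qfact (n - k + k)"
      using gauss_qfact[OF True] True by (simp add: mult_ac)
    also have "\<dots> = qfact (n - k) * (\<Prod>i=1..k. qint (n - k + i))"
      by (rule qfact_add)
    finally have "(\<Prod>i=1..k. qint (n - k + i)) = gauss n k * qfact k"
      by simp
    then show ?thesis by simp
  qed
  finally show ?thesis .
qed (simp add: qbinom_def)

section \<open>The two expressions of the theorem\<close>

lemma nonneg_int_polynomial_to_fract:
  "(\<And>i. 0 \<le> coeff p i) \<Longrightarrow> nonneg_int_polynomial (to_fract p)"
  by (auto simp: nonneg_int_polynomial_def)

lemma nonneg_int_polynomial_0: "nonneg_int_polynomial 0"
  using nonneg_int_polynomial_to_fract[of 0] by simp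

text \<open>Both sides are multiplied by \<open>[k+1][2k, k]\<close>. The factor
  \<open>[2k, k]\<close> trades \<open>[n+k, 2k]\<close> for \<open>[n, k][n+k, k]\<close>, and it
  is regained when \<open>[m, k][m+k, k]\<close> is turned back into
  \<open>[m+k, 2k][2k, k]\<close>.\<close>

lemma first_product_eq:
  assumes "k < n" and "k \<le> m"
  shows "qint (n - k) * qint (Suc k) * gauss (n + k) (2 * k) * gauss (m + 1) (k + 1) * gauss (m + k) (k + 1) =
    qint n * (gauss (n + k) k * gauss (n - 1) k * gauss_quot m k)"
proof -
  let ?C = "gauss (2 * k) k"
  have n: "qint (n - k) * gauss n k = qint n * gauss (n - 1) k"
    using gauss_absorb_left[of "n - 1" k] assms by simp
  have m: "qint (Suc k) * gauss (m + 1) (k + 1) = qint (Suc m) * gauss m k"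
    using gauss_absorb_top[of k m] by simp
  have mk: "qint (Suc k) * gauss (m + k) (k + 1) = qint m * gauss (m + k) k"
    using gauss_absorb_right[of k "m + k"] by simp
  have "(qint (Suc k) * ?C) * (qint (n - k) * qint (Suc k) * gauss (n + k) (2 * k) *
        gauss (m + 1) (k + 1) * gauss (m + k) (k + 1)) =
      qint (n - k) * (gauss (n + k) (2 * k) * ?C) *
        (qint (Suc k) * gauss (m + 1) (k + 1)) * (qint (Suc k) * gauss (m + k) (k + 1))"
    by (simp only: mult_ac)
  also have "\<dots> = (qint (n - k) * gauss n k) * gauss (n + k) k * (qint m * qint (Suc m)) *
      (gauss m k * gauss (m + k) k)"
    using assms by (simp only: m mk gauss_central_mult less_imp_le) (simp only: mult_ac)
  also have "\<dots> = qint n * gauss (n - 1) k * gauss (n + k) k * ?C *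
      (qint m * qint (Suc m) * gauss (m + k) (2 * k))"
    unfolding n gauss_central_mult[OF assms(2), symmetric] by (simp only: mult_ac)
  also have "\<dots> = (qint (Suc k) * ?C) * (qint n * (gauss (n + k) k * gauss (n - 1) k * gauss_quot m k))"
    unfolding gauss_quot[OF assms(2)] by (simp only: mult_ac)
  finally show ?thesis
    using gauss_nonzero[of k "2 * k"] by (simp only: mult_cancel_left) simp
qed

theorem theorem2p1:
  fixes m n j k :: nat
  assumes "m > 0" and "n > 0"
  shows "nonneg_int_polynomial
           ((1 - q powi (int n - int k)) * (1 - q ^ (k + 1)) / ((1 - q) * (1 - q ^ n))
             * qbinom (n + k) (2 * k) * qbinom (m + 1) (k + 1) * qbinom (m + k) (k + 1))
       \<and> nonneg_int_polynomial
           ((1 - q) / (1 - q ^ (k + 1))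
             * qbinom (n - 1) k * qbinom (n + k) k * qbinom (2 * k) (j + k)
             * qbinom (m + k) (2 * k) * qbinom m j * qbinom (m + j) j)"
proof (rule conjI)
  show "nonneg_int_polynomial
      ((1 - q powi (int n - int k)) * (1 - q ^ (k + 1)) / ((1 - q) * (1 - q ^ n))
        * qbinom (n + k) (2 * k) * qbinom (m + 1) (k + 1) * qbinom (m + k) (k + 1))"
    (is "nonneg_int_polynomial ?X")
  proof (cases "k < n \<and> k \<le> m")
    case True
    then have k: "k < n" "k \<le> m" by auto
    have "q powi (int n - int k) = q ^ (n - k)"
      using k by (simp add: power_int_def nat_diff_distrib')
    \<comment> \<open>Here \<open>u\<close> stands for \<open>1 - q\<close> and \<open>c\<close> for
      \<open>[n]\<close>.\<close>
    moreover have "(u * a) * (u * b) / (u * (u * c)) * x * y * z * c = a * b * x * y * z"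
      if "u \<noteq> 0" "c \<noteq> 0" for a b c u x y z :: "int poly fract"
      using that by (simp add: field_simps)
    ultimately have "?X * to_fract (qint n) = to_fract (qint (n - k) * qint (Suc k) * gauss (n + k) (2 * k) *
        gauss (m + 1) (k + 1) * gauss (m + k) (k + 1))"
      using one_minus_q_nonzero assms(2)
      by (simp only: one_minus_q_power qbinom_eq_gauss to_fract_mult to_fract_eq_0_iff
          qint_eq_0_iff Suc_eq_plus1 not_False_eq_True neq0_conv)
    also have "\<dots> = to_fract (gauss (n + k) k * gauss (n - 1) k * gauss_quot m k) * to_fract (qint n)"
      unfolding first_product_eq[OF k] by (simp only: to_fract_mult mult_ac)
    finally have "?X = to_fract (gauss (n + k) k * gauss (n - 1) k * gauss_quot m k)"
      using assms(2) by (simp only: mult_cancel_right to_fract_eq_0_iff qint_eq_0_iff) simp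
    then show ?thesis
      by (simp only:) (intro nonneg_int_polynomial_to_fract nonneg_coeff_mult coeff_gauss_nonneg
          coeff_gauss_quot_nonneg)
  next
    case False
    then consider "n < k" | "n = k" | "m < k" by linarith
    \<comment> \<open>The vanishing factor is \<open>[n+k, 2k]\<close>, \<open>1 - q^(n-k)\<close>
      or \<open>[m+1, k+1]\<close>, respectively.\<close>
    then have "?X = 0"
      by cases (simp_all add: qbinom_eq_gauss)
    then show ?thesis by (simp only: nonneg_int_polynomial_0)
  qed
  show "nonneg_int_polynomial
      ((1 - q) / (1 - q ^ (k + 1))
        * qbinom (n - 1) k * qbinom (n + k) k * qbinom (2 * k) (j + k)
        * qbinom (m + k) (2 * k) * qbinom m j * qbinom (m + j) j)"
    (is "nonneg_int_polynomial ?Y")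
  proof (cases "k \<le> m \<and> j \<le> k")
    case True
    let ?P = "gauss (n - 1) k * gauss (n + k) k *
      (gauss (2 * k) (j + k) * gauss (m + k) (2 * k) * gauss m j * gauss (m + j) j)"
    have "qint (Suc k) dvd ?P"
      using True by (intro dvd_mult qint_Suc_dvd_gauss_product) auto
    then obtain r where r: "?P = qint (Suc k) * r" by (elim dvdE)
    have "u / (u * c) * v * w * x * y * z * t * c = v * w * (x * y * z * t)"
      if "u \<noteq> 0" "c \<noteq> 0" for c t u v w x y z :: "int poly fract"
      using that by (simp add: field_simps)
    then have "?Y * to_fract (qint (Suc k)) = to_fract ?P"
      using one_minus_q_nonzero
      by (simp only: one_minus_q_power qbinom_eq_gauss to_fract_mult to_fract_eq_0_iff
          qint_eq_0_iff Suc_eq_plus1 not_False_eq_True add_is_0 one_neq_zero simp_thms)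
    then have "?Y * to_fract (qint (Suc k)) = to_fract r * to_fract (qint (Suc k))"
      unfolding r by (simp only: to_fract_mult mult.commute)
    then have "?Y = to_fract r"
      by (simp only: mult_cancel_right to_fract_eq_0_iff qint_eq_0_iff) simp
    moreover have "0 \<le> coeff r i" for i
    proof -
      obtain d where su: "symm_unimodal d ?P"
        using symm_unimodal_mult symm_unimodal_gauss by meson
      show ?thesis
        by (rule coeff_nonneg_if_quotient_symm_unimodal[OF su _ r]) simp
    qed
    ultimately show ?thesis
      by (simp only: nonneg_int_polynomial_to_fract)
  next
    case False
    \<comment> \<open>\<open>[m+k, 2k]\<close> vanishes for \<open>m < k\<close>, and
      \<open>[2k, j+k]\<close> for \<open>k < j\<close>.\<close>
    then have "?Y = 0"
      by (auto simp: qbinom_eq_gauss)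
    then show ?thesis by (simp only: nonneg_int_polynomial_0)
  qed
qed

end
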